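(* Let $\mathcal{H}$ be a complex Hilbert space, $x,y\in\mathcal{H}$ and $T\in\mathcal{B}(\mathcal{H})$. Then the following are equivalent: (i) $T\in\mathcal{D}_{x\otimes y}$; (ii) $x\otimes y$ majorizes $x\otimes T^*y$; (iii) there exists $M>0$ such that $|\langle z,T^*y\rangle|\le M|\langle z,y\rangle|$ for all $z\in\mathcal{H}$. Moreover, $\mathcal{D}_{(x\otimes y)^n}=\mathcal{D}_{x\otimes y}$ for every $n\in\mathbb{N}$.
   Context: $\mathcal{B}(\mathcal{H})$ is the algebra of all bounded linear operators on $\mathcal{H}$. For $x,y\in\mathcal{H}$, $x\otimes y\in\mathcal{B}(\mathcal{H})$ is the operator $(x\otimes y)h=\langle h,y\rangle x$. For $T,S\in\mathcal{B}(\mathcal{H})$, $T$ majorizes $S$ if there is $M>0$ with $\|Sx\|\le M\|Tx\|$ for all $x\in\mathcal{H}$. For $A\in\mathcal{B}(\mathcal{H})$ the Deddens algebra $\mathcal{D}_A$ is the set of all $S\in\mathcal{B}(\mathcal{H})$ for which there is $M>0$ with $\|A^nSx\|\le M\|A^nx\|$ for all $n\in\mathbb{N}$ and $x\in\mathcal{H}$.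
   Formalization: The implication (ii)⇒(iii) is stated for x ≠ 0 only (it fails for x = 0 in general), and the power identity is stated for n ≥ 1 with n = 1, x = 0, y = 0 or ⟨x,y⟩ ≠ 0 (it fails for n ≥ 2 with x, y nonzero and orthogonal). *)

theory Defs
  imports "HOL-Analysis.Analysis"
begin

text \<open>
  Complex inner product spaces. The inner product is linear in its first and conjugate linear
  in its second argument, and the norm, metric and real vector space structure are those of the
  ambient \<^class>\<open>real_normed_vector\<close>; positive definiteness is inherited from the norm.
\<close>

class complex_inner = real_normed_vector +
  fixes scaleC :: "complex \<Rightarrow> 'a \<Rightarrow> 'a" (infixr "*\<^sub>C" 75)
    and cinner :: "'a \<Rightarrow> 'a \<Rightarrow> complex"
  assumes scaleC_add_right: "c *\<^sub>C (x + y) = c *\<^sub>C x + c *\<^sub>C y"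
    and scaleC_add_left: "(c + d) *\<^sub>C x = c *\<^sub>C x + d *\<^sub>C x"
    and scaleC_scaleC: "c *\<^sub>C (d *\<^sub>C x) = (c * d) *\<^sub>C x"
    and scaleC_of_real: "complex_of_real r *\<^sub>C x = r *\<^sub>R x"
    and cinner_add_left: "cinner (x + y) z = cinner x z + cinner y z"
    and cinner_scaleC_left: "cinner (c *\<^sub>C x) y = c * cinner x y"
    and cinner_commute: "cinner x y = cnj (cinner y x)"
    and cinner_self: "cinner x x = complex_of_real ((norm x)\<^sup>2)"

class chilbert_space = complex_inner + complete_space

definition bounded_clinear :: "('a::complex_inner \<Rightarrow> 'b::complex_inner) \<Rightarrow> bool" where
  "bounded_clinear T \<longleftrightarrow> bounded_linear T \<and> (\<forall>c x. T (c *\<^sub>C x) = c *\<^sub>C T x)"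

text \<open>The Hilbert space adjoint; the characterizing \<open>S\<close> is unique, and it exists for every
  bounded operator between Hilbert spaces.\<close>

definition cadjoint ::
    "('a::chilbert_space \<Rightarrow> 'b::chilbert_space) \<Rightarrow> 'b \<Rightarrow> 'a" where
  "cadjoint T = (THE S. \<forall>u v. cinner (T u) v = cinner u (S v))"

definition rank_one_op :: "'a::complex_inner \<Rightarrow> 'a \<Rightarrow> 'a \<Rightarrow> 'a" (infix "\<otimes>\<^sub>o" 80) where
  "x \<otimes>\<^sub>o y = (\<lambda>h. cinner h y *\<^sub>C x)"

definition majorizes ::
    "('a::complex_inner \<Rightarrow> 'a) \<Rightarrow> ('a \<Rightarrow> 'a) \<Rightarrow> bool" where
  "majorizes T S \<longleftrightarrow> (\<exists>M>0. \<forall>u. norm (S u) \<le> M * norm (T u))"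

text \<open>Natural numbers are counted from 1 here. For the Deddens algebra this is immaterial,
  since the condition for \<open>n = 0\<close> is just boundedness of \<open>S\<close>.\<close>

definition deddens_algebra :: "('a::complex_inner \<Rightarrow> 'a) \<Rightarrow> ('a \<Rightarrow> 'a) set" where
  "deddens_algebra A = {S. bounded_clinear S \<and>
     (\<exists>M>0. \<forall>n\<ge>1. \<forall>u. norm ((A ^^ n) (S u)) \<le> M * norm ((A ^^ n) u))}"

lemma deddens_algebra_from_0:
  "deddens_algebra A = {S. bounded_clinear S \<and>
     (\<exists>M>0. \<forall>n. \<forall>u. norm ((A ^^ n) (S u)) \<le> M * norm ((A ^^ n) u))}"
proof -
  have "\<exists>M>0. \<forall>n. \<forall>u. norm ((A ^^ n) (S u)) \<le> M * norm ((A ^^ n) u)"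
    if S: "bounded_clinear S" and M: "M > 0"
      and le: "\<forall>n\<ge>1. \<forall>u. norm ((A ^^ n) (S u)) \<le> M * norm ((A ^^ n) u)" for S M
  proof -
    from S obtain K where K: "\<And>u. norm (S u) \<le> norm u * K"
      unfolding bounded_clinear_def using bounded_linear.bounded by blast
    have "norm ((A ^^ n) (S u)) \<le> max M K * norm ((A ^^ n) u)" for n u
    proof (cases "n = 0")
      case True
      have "norm u * K \<le> max M K * norm u"
        using mult_left_mono[of K "max M K" "norm u"] by (simp add: mult.commute)
      with K[of u] True show ?thesis by simp
    next
      case False
      then have "norm ((A ^^ n) (S u)) \<le> M * norm ((A ^^ n) u)" using le by simp
      also have "\<dots> \<le> max M K * norm ((A ^^ n) u)" by (simp add: mult_right_mono)
      finally show ?thesis .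
    qed
    moreover have "max M K > 0" using M by simp
    ultimately show ?thesis by blast
  qed
  then show ?thesis unfolding deddens_algebra_def by blast
qed

end

theory Submission
  imports Defs
begin

text \<open>
  Since \<open>\<langle>T u, y\<rangle> = \<langle>u, T\<^sup>* y\<rangle>\<close> and \<open>(x \<otimes> y)\<^sup>n u = \<langle>x, y\<rangle>\<^sup>n\<^sup>-\<^sup>1 (x \<otimes> y) u\<close> for \<open>n \<ge> 1\<close>, all the
  inequalities defining \<open>T \<in> \<D>\<^bsub>x\<otimes>y\<^esub>\<close> are multiples of the one for \<open>n = 1\<close>, which is the
  majorization (ii). The adjoint exists by the Riesz representation theorem: a bounded real
  functional \<open>r\<close> is represented by the minimizer of \<open>\<parallel>u\<parallel>\<^sup>2 - 2 r u\<close>.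
\<close>

section \<open>Inner product calculus\<close>

lemma cinner_add_right: "cinner x (y + z) = cinner x y + cinner x z"
  by (metis cinner_add_left cinner_commute complex_cnj_add)

lemma scaleC_minus_one: "(-1) *\<^sub>C x = - x"
  using scaleC_of_real[of "-1" x] by simp

lemma cinner_minus_left: "cinner (- x) y = - cinner x y"
  using cinner_scaleC_left[of "-1" x y] by (simp add: scaleC_minus_one)

lemma cinner_minus_right: "cinner x (- y) = - cinner x y"
  by (metis cinner_minus_left cinner_commute complex_cnj_minus)

lemma cinner_diff_right: "cinner x (y - z) = cinner x y - cinner x z"
  using cinner_add_right[of x y "- z"] by (simp add: cinner_minus_right)

lemma cinner_zero_left: "cinner 0 x = 0"
  using cinner_add_left[of 0 0 x] by simp

lemma cinner_zero_right: "cinner x 0 = 0"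
  by (metis cinner_zero_left cinner_commute complex_cnj_zero)

lemma cinner_scaleR_left: "cinner (r *\<^sub>R x) y = of_real r * cinner x y"
  by (metis cinner_scaleC_left scaleC_of_real)

lemma norm_scaleC: "norm (c *\<^sub>C x) = cmod c * norm x"
proof -
  have "cinner (c *\<^sub>C x) (c *\<^sub>C x) = c * cnj (c * cinner x x)"
    by (metis cinner_scaleC_left cinner_commute)
  also have "\<dots> = (c * cnj c) * complex_of_real ((norm x)\<^sup>2)"
    by (simp add: cinner_self)
  also have "\<dots> = complex_of_real ((cmod c * norm x)\<^sup>2)"
    by (simp add: complex_norm_square[symmetric] power_mult_distrib)
  finally have "(norm (c *\<^sub>C x))\<^sup>2 = (cmod c * norm x)\<^sup>2"
    unfolding cinner_self of_real_eq_iff .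
  then show ?thesis
    by (simp add: power2_eq_iff_nonneg)
qed

lemma norm_add_square:
  "(norm (x + y))\<^sup>2 = (norm x)\<^sup>2 + 2 * Re (cinner x y) + (norm y)\<^sup>2"
proof -
  have "complex_of_real ((norm (x + y))\<^sup>2)
      = complex_of_real ((norm x)\<^sup>2) + complex_of_real ((norm y)\<^sup>2)
        + (cinner x y + cnj (cinner x y))"
    by (simp only: cinner_self[symmetric] cinner_add_left cinner_add_right
        cinner_commute[of y x, symmetric]) (simp add: add_ac)
  also have "\<dots> = complex_of_real ((norm x)\<^sup>2 + (norm y)\<^sup>2 + 2 * Re (cinner x y))"
    by (simp add: complex_add_cnj)
  finally show ?thesis
    unfolding of_real_eq_iff by simp
qed

lemma parallelogram_law:
  fixes x y :: "'a::complex_inner"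
  shows "(norm (x + y))\<^sup>2 + (norm (x - y))\<^sup>2 = 2 * (norm x)\<^sup>2 + 2 * (norm y)\<^sup>2"
  using norm_add_square[of x y] norm_add_square[of x "- y"]
  by (simp add: cinner_minus_right)

text \<open>The usual order is reversed: the triangle inequality comes with the norm, and expanding
  its square bounds the real part of the inner product.\<close>

lemma cinner_Cauchy_Schwarz: "cmod (cinner x y) \<le> norm x * norm y"
proof -
  have re: "Re (cinner u v) \<le> norm u * norm v" for u v :: 'a
  proof -
    have "(norm (u + v))\<^sup>2 \<le> (norm u + norm v)\<^sup>2"
      by (intro power_mono norm_triangle_ineq) simp
    then show ?thesis
      by (simp add: norm_add_square power2_sum)
  qed
  \<comment> \<open>A phase (or 0) that rotates \<open>cinner x y\<close> onto the nonnegative real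
    axis, where modulus and real part agree.\<close>
  define c where "c = cnj (sgn (cinner x y))"
  have "c * cinner x y = complex_of_real (cmod (cinner x y))"
    by (cases "cinner x y = 0")
      (simp_all add: c_def sgn_eq mult.commute complex_norm_square[symmetric] power2_eq_square)
  then have "cmod (cinner x y) = Re (cinner (c *\<^sub>C x) y)"
    by (simp add: cinner_scaleC_left)
  also have "\<dots> \<le> cmod c * norm x * norm y"
    using re[of "c *\<^sub>C x" y] by (simp add: norm_scaleC)
  also have "\<dots> \<le> norm x * norm y"
    by (auto simp: c_def norm_sgn)
  finally show ?thesis .
qed

lemma cinner_left_unique:
  assumes "\<And>u. cinner u v = cinner u w"
  shows "v = w"
proof -
  have "cinner (v - w) (v - w) = 0"
    using assms by (simp add: cinner_diff_right)
  then show ?thesis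
    by (simp add: cinner_self)
qed

section \<open>Riesz representation and the adjoint\<close>

lemma quadratic_nonneg_imp_zero:
  fixes a b :: real
  assumes "\<And>t. 0 \<le> t\<^sup>2 * a + 2 * t * b"
  shows "b = 0"
proof (rule ccontr)
  assume b: "b \<noteq> 0"
  \<comment> \<open>Any positive \<open>c\<close> with \<open>a < 2 * c\<close> makes the quadratic
    negative at \<open>t = - b / c\<close>.\<close>
  define c where "c = \<bar>a\<bar> + 1"
  have c: "c > 0" "a < 2 * c" by (auto simp: c_def)
  have "(- b / c)\<^sup>2 * a + 2 * (- b / c) * b = (b / c)\<^sup>2 * (a - 2 * c)"
    using c by (simp add: field_simps power2_eq_square)
  also have "\<dots> < 0"
    using b c by (simp add: mult_pos_neg)
  finally show False
    using assms[of "- b / c"] by simp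
qed

text \<open>If \<open>w\<close> represents \<open>r\<close>, then \<open>J u\<close> below equals
  the squared distance from \<open>u\<close> to \<open>w\<close> minus the squared norm of
  \<open>w\<close>; hence \<open>w\<close> is sought as the minimizer of \<open>J\<close>.\<close>

lemma Riesz_representation_Re:
  fixes r :: "'a::chilbert_space \<Rightarrow> real"
  assumes "bounded_linear r"
  shows "\<exists>w. \<forall>u. r u = Re (cinner u w)"
proof -
  interpret r: bounded_linear r by fact
  define J where "J u = (norm u)\<^sup>2 - 2 * r u" for u
  obtain K where K: "\<And>u. \<bar>r u\<bar> \<le> norm u * K"
    using r.bounded by auto
  have "- K\<^sup>2 \<le> J u" for u
  proof -
    have "0 \<le> (norm u - K)\<^sup>2" by simp
    then show ?thesis
      using K[of u] by (simp add: J_def power2_diff)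
  qed
  then have bdd: "bdd_below (range J)"
    by (intro bdd_belowI[of _ "- K\<^sup>2"]) auto
  define m where "m = Inf (range J)"
  have m: "m \<le> J u" for u
    unfolding m_def by (intro cInf_lower bdd) auto
  have "\<exists>u. J u < m + 1 / real (Suc n)" for n
    using cInf_lessD[of "range J" "m + 1 / real (Suc n)"] by (auto simp: m_def)
  then obtain X where X: "\<And>n. J (X n) < m + 1 / real (Suc n)"
    by metis
  \<comment> \<open>Near-minimizers are close together: by the parallelogram law,
    \<open>J u + J v\<close> exceeds twice the value of \<open>J\<close> at the midpoint by half of
    \<open>(norm (u - v))\<^sup>2\<close>, and the midpoint value is at least
    \<open>m\<close>.\<close>
  have mid: "(norm (u - v))\<^sup>2 \<le> 2 * (J u - m) + 2 * (J v - m)" for u v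
  proof -
    have "J ((1/2) *\<^sub>R (u + v)) = (norm (u + v))\<^sup>2 / 4 - (r u + r v)"
      by (simp add: J_def r.scaleR r.add power_divide add_divide_distrib)
    with m[of "(1/2) *\<^sub>R (u + v)"] show ?thesis
      using parallelogram_law[of u v] by (simp add: J_def)
  qed
  have "Cauchy X"
  proof (rule CauchyI)
    fix e :: real assume e: "e > 0"
    then obtain N where N: "1 / real (Suc N) < e\<^sup>2 / 4"
      by (metis divide_pos_pos zero_less_numeral zero_less_power nat_approx_posE)
    have "norm (X i - X j) < e" if "i \<ge> N" "j \<ge> N" for i j
    proof -
      have small: "J (X k) - m < e\<^sup>2 / 4" if "k \<ge> N" for k
      proof -
        have "1 / real (Suc k) \<le> 1 / real (Suc N)"
          using that by (simp add: frac_le)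
        with X[of k] N show ?thesis by linarith
      qed
      have "(norm (X i - X j))\<^sup>2 \<le> 2 * (J (X i) - m) + 2 * (J (X j) - m)"
        by (rule mid)
      also have "\<dots> < 2 * (e\<^sup>2 / 4) + 2 * (e\<^sup>2 / 4)"
        using small[OF that(1)] small[OF that(2)] by (intro add_strict_mono) simp_all
      finally have "(norm (X i - X j))\<^sup>2 < e\<^sup>2" by simp
      then show ?thesis
        using e by (simp add: power2_less_imp_less)
    qed
    then show "\<exists>N. \<forall>i\<ge>N. \<forall>j\<ge>N. norm (X i - X j) < e" by blast
  qed
  then obtain w where w: "X \<longlonglongrightarrow> w"
    using Cauchy_convergent convergentD by blast
  have "(\<lambda>n. J (X n)) \<longlonglongrightarrow> J w"
    unfolding J_def by (intro tendsto_intros r.tendsto w)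
  moreover have "(\<lambda>n. m + 1 / real (Suc n)) \<longlonglongrightarrow> m + 0"
    by (intro tendsto_intros LIMSEQ_inverse_real_of_nat[unfolded inverse_eq_divide])
  ultimately have "J w \<le> m + 0"
    by (rule LIMSEQ_le) (use X less_imp_le in blast)
  then have min: "J w \<le> J u" for u
    using m[of u] by simp
  have "r h = Re (cinner h w)" for h
  proof -
    \<comment> \<open>The right-hand side is \<open>J (t *\<^sub>R h + w) - J w\<close>; its linear
      coefficient in \<open>t\<close> must vanish at a minimum.\<close>
    have "0 \<le> t\<^sup>2 * (norm h)\<^sup>2 + 2 * t * (Re (cinner h w) - r h)" for t
      using min[of "t *\<^sub>R h + w"] norm_add_square[of "t *\<^sub>R h" w]
      by (simp add: J_def r.add r.scaleR cinner_scaleR_left power_mult_distrib algebra_simps)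
    then show ?thesis
      using quadratic_nonneg_imp_zero by force
  qed
  then show ?thesis by blast
qed

lemma Riesz_representation:
  fixes f :: "'a::chilbert_space \<Rightarrow> complex"
  assumes bl: "bounded_linear f" and f: "\<And>c u. f (c *\<^sub>C u) = c * f u"
  shows "\<exists>w. \<forall>u. f u = cinner u w"
proof -
  have "bounded_linear (\<lambda>u. Re (f u))"
    by (rule bounded_linear_compose[OF bounded_linear_Re bl])
  then obtain w where w: "\<And>u. Re (f u) = Re (cinner u w)"
    using Riesz_representation_Re by blast
  \<comment> \<open>A complex linear functional is determined by its real part, since Re f(iu) = -
    Im f(u).\<close>
  have "Im (f u) = Im (cinner u w)" for u
    using w[of "\<i> *\<^sub>C u"] by (simp add: f cinner_scaleC_left)
  then show ?thesis
    using w complex_eqI by blast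
qed

text \<open>Riesz representation, applied for each fixed second argument, supplies the operator that
  the \<open>THE\<close> in \<open>cadjoint\<close> picks out.\<close>

lemma cinner_cadjoint:
  fixes T :: "'a::chilbert_space \<Rightarrow> 'b::chilbert_space"
  assumes "bounded_clinear T"
  shows "cinner u (cadjoint T v) = cinner (T u) v"
proof -
  have bl: "bounded_linear T" and TC: "\<And>c u. T (c *\<^sub>C u) = c *\<^sub>C T u"
    using assms by (auto simp: bounded_clinear_def)
  have "\<exists>w. \<forall>u. cinner (T u) z = cinner u w" for z
  proof (rule Riesz_representation)
    have "bounded_linear (\<lambda>h. cinner h z)"
      by (rule bounded_linear_intro[where K = "norm z"])
        (simp_all add: cinner_add_left cinner_scaleR_left cinner_Cauchy_Schwarz scaleR_conv_of_real)
    then show "bounded_linear (\<lambda>u. cinner (T u) z)"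
      by (rule bounded_linear_compose[OF _ bl])
  qed (simp add: TC cinner_scaleC_left)
  then obtain S where S: "\<forall>u v. cinner (T u) v = cinner u (S v)"
    by metis
  have "cadjoint T = S"
    unfolding cadjoint_def
  proof (rule the_equality)
    show "S' = S" if "\<forall>u v. cinner (T u) v = cinner u (S' v)" for S'
      using that S by (intro ext cinner_left_unique) metis
  qed (fact S)
  then show ?thesis
    using S by simp
qed

section \<open>Rank-one operators and their Deddens algebras\<close>

lemma norm_rank_one_op: "norm ((x \<otimes>\<^sub>o y) u) = cmod (cinner u y) * norm x"
  by (simp add: rank_one_op_def norm_scaleC)

text \<open>Every application after the first only contributes a scalar factor
  \<open>cinner x y\<close>. The exponent \<open>Suc n\<close> leaves out the zeroth power, which is
  the identity.\<close>

lemma norm_rank_one_op_funpow: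
  "norm (((x \<otimes>\<^sub>o y) ^^ Suc n) u) = cmod (cinner x y) ^ n * norm ((x \<otimes>\<^sub>o y) u)"
proof -
  have "((x \<otimes>\<^sub>o y) ^^ Suc n) u = (cinner x y ^ n * cinner u y) *\<^sub>C x"
    by (induction n) (simp_all add: rank_one_op_def cinner_scaleC_left mult_ac)
  then show ?thesis
    by (simp add: norm_scaleC norm_mult norm_power norm_rank_one_op)
qed

lemma deddens_algebra_rank_one_op:
  "deddens_algebra (x \<otimes>\<^sub>o y) = {S. bounded_clinear S \<and>
     (\<exists>M>0. \<forall>u. norm ((x \<otimes>\<^sub>o y) (S u)) \<le> M * norm ((x \<otimes>\<^sub>o y) u))}"
proof -
  let ?A = "x \<otimes>\<^sub>o y"
  have "(\<forall>n\<ge>1. \<forall>u. norm ((?A ^^ n) (S u)) \<le> M * norm ((?A ^^ n) u))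
      \<longleftrightarrow> (\<forall>u. norm (?A (S u)) \<le> M * norm (?A u))" (is "?L \<longleftrightarrow> ?R") for S M
  proof
    assume ?L
    then show ?R by (auto dest: spec[of _ 1])
  next
    assume R: ?R
    show ?L
    proof (intro allI impI)
      fix n u assume "n \<ge> (1::nat)"
      then obtain k where n: "n = Suc k" by (cases n) auto
      have "cmod (cinner x y) ^ k * norm (?A (S u)) \<le> cmod (cinner x y) ^ k * (M * norm (?A u))"
        using R by (intro mult_left_mono) auto
      then show "norm ((?A ^^ n) (S u)) \<le> M * norm ((?A ^^ n) u)"
        unfolding n norm_rank_one_op_funpow by (simp only: mult_ac)
    qed
  qed
  then show ?thesis
    unfolding deddens_algebra_def by simp
qed

text \<open>The powers of \<open>A ^^ n\<close> are among those of \<open>A\<close>, so fewer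
  inequalities are imposed.\<close>

lemma deddens_algebra_subset_funpow:
  assumes "n \<ge> 1"
  shows "deddens_algebra A \<subseteq> deddens_algebra (A ^^ n)"
proof -
  have "n * k \<ge> 1" if "k \<ge> 1" for k
    using assms that by simp
  then show ?thesis
    unfolding deddens_algebra_def funpow_mult by auto
qed

lemma deddens_algebra_rank_one_op_funpow:
  fixes x y :: "'a::complex_inner"
  assumes n: "n \<ge> 1" and nz: "x = 0 \<or> y = 0 \<or> cinner x y \<noteq> 0"
  shows "deddens_algebra ((x \<otimes>\<^sub>o y) ^^ n) = deddens_algebra (x \<otimes>\<^sub>o y)"
proof (rule antisym)
  let ?A = "x \<otimes>\<^sub>o y"
  show "deddens_algebra (?A ^^ n) \<subseteq> deddens_algebra ?A"
  proof
    fix S assume S: "S \<in> deddens_algebra (?A ^^ n)"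
    obtain k where k: "n = Suc k" using n by (cases n) auto
    from S obtain M where M: "M > 0"
      and "\<And>j u. j \<ge> 1 \<Longrightarrow> norm (((?A ^^ n) ^^ j) (S u)) \<le> M * norm (((?A ^^ n) ^^ j) u)"
      unfolding deddens_algebra_def by blast
    then have "norm ((?A ^^ n) (S u)) \<le> M * norm ((?A ^^ n) u)" for u
      by (metis One_nat_def funpow_0 funpow_simps_right(2) comp_apply order_refl)
    \<comment> \<open>The inequality for the first power of \<open>?A ^^ n\<close> is the one for
      \<open>?A\<close> times a common factor, which cancels when \<open>cinner x y\<close> is
      nonzero. Otherwise \<open>nz\<close> forces \<open>?A\<close> to be zero.\<close>
    then have le: "cmod (cinner x y) ^ k * norm (?A (S u))
        \<le> cmod (cinner x y) ^ k * (M * norm (?A u))" for u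
      unfolding k by (simp only: norm_rank_one_op_funpow mult_ac)
    have "norm (?A (S u)) \<le> M * norm (?A u)" for u
    proof (cases "cinner x y = 0")
      case True
      with nz show ?thesis by (auto simp: norm_rank_one_op cinner_zero_right)
    next
      case False
      then show ?thesis using le[of u] by simp
    qed
    with M S show "S \<in> deddens_algebra ?A"
      unfolding deddens_algebra_rank_one_op by (auto simp: deddens_algebra_def)
  qed
qed (rule deddens_algebra_subset_funpow[OF n])

text \<open>The case distinctions matter. For \<open>x = 0\<close> majorization always holds,
  whereas (iii) forces the adjoint to map \<open>y\<close> to a multiple of \<open>y\<close>. For
  nonzero orthogonal \<open>x\<close> and \<open>y\<close>, all powers with \<open>n \<ge> 2\<close>
  vanish, so their Deddens algebra contains every bounded operator, while that of
  \<open>x \<otimes>\<^sub>o y\<close> is smaller.\<close>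

theorem theorem2p3:
  fixes x y :: "'a::chilbert_space" and T :: "'a \<Rightarrow> 'a"
  assumes "bounded_clinear T"
  shows "(T \<in> deddens_algebra (x \<otimes>\<^sub>o y)
            \<longleftrightarrow> majorizes (x \<otimes>\<^sub>o y) (x \<otimes>\<^sub>o cadjoint T y))
       \<and> ((\<exists>M>0. \<forall>z. cmod (cinner z (cadjoint T y)) \<le> M * cmod (cinner z y))
            \<longrightarrow> majorizes (x \<otimes>\<^sub>o y) (x \<otimes>\<^sub>o cadjoint T y))
       \<and> (x \<noteq> 0 \<longrightarrow> majorizes (x \<otimes>\<^sub>o y) (x \<otimes>\<^sub>o cadjoint T y)
            \<longrightarrow> (\<exists>M>0. \<forall>z. cmod (cinner z (cadjoint T y)) \<le> M * cmod (cinner z y)))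
       \<and> (\<forall>n\<ge>1. n = 1 \<or> x = 0 \<or> y = 0 \<or> cinner x y \<noteq> 0
            \<longrightarrow> deddens_algebra ((x \<otimes>\<^sub>o y) ^^ n) = deddens_algebra (x \<otimes>\<^sub>o y))"
proof (intro conjI)
  let ?ii = "majorizes (x \<otimes>\<^sub>o y) (x \<otimes>\<^sub>o cadjoint T y)"
  let ?iii = "\<exists>M>0. \<forall>z. cmod (cinner z (cadjoint T y)) \<le> M * cmod (cinner z y)"
  show "T \<in> deddens_algebra (x \<otimes>\<^sub>o y) \<longleftrightarrow> ?ii"
    using assms
    by (simp add: deddens_algebra_rank_one_op majorizes_def norm_rank_one_op cinner_cadjoint)
  \<comment> \<open>Majorization is (iii) with both sides multiplied by \<open>norm x\<close>, so
    the converse cancels this factor when \<open>x\<close> is nonzero.\<close>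
  have "cmod (cinner z (cadjoint T y)) * norm x \<le> M * (cmod (cinner z y) * norm x)"
    if "cmod (cinner z (cadjoint T y)) \<le> M * cmod (cinner z y)" for M z
    using mult_right_mono[OF that norm_ge_zero[of x]] by (simp only: mult.assoc)
  then show "?iii \<longrightarrow> ?ii"
    unfolding majorizes_def norm_rank_one_op by blast
  show "x \<noteq> 0 \<longrightarrow> ?ii \<longrightarrow> ?iii"
    by (simp add: majorizes_def norm_rank_one_op mult.assoc[symmetric])
  show "\<forall>n\<ge>1. n = 1 \<or> x = 0 \<or> y = 0 \<or> cinner x y \<noteq> 0
      \<longrightarrow> deddens_algebra ((x \<otimes>\<^sub>o y) ^^ n) = deddens_algebra (x \<otimes>\<^sub>o y)"
    using deddens_algebra_rank_one_op_funpow by auto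
qed

end
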